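(* Let $K$ be an algebraically closed field, let $N\geq 1$, let $K[\mathbf{P}^{N+1}]=K[x_0,\ldots,x_{N+1}]$, let $H\subset\mathbf{P}^{N+1}$ be the hyperplane $x_0=0$, identified with $\mathbf{P}^N$, with $K[\mathbf{P}^N]=K[x_1,\ldots,x_{N+1}]$. Let $P_1,\ldots,P_n$ ($n\ge 1$) be distinct points of $H$. Let $I\subset K[\mathbf{P}^N]$ be the radical ideal of $\{P_1,\ldots,P_n\}$ regarded as a subset of $\mathbf{P}^N=H$, and let $\widehat{I}\subset K[\mathbf{P}^{N+1}]$ be the radical ideal of $\{P_1,\ldots,P_n\}$ regarded as a subset of $\mathbf{P}^{N+1}$. Let $M=(x_1,\ldots,x_{N+1})\subset K[\mathbf{P}^N]$ and $\widehat{M}=(x_0,\ldots,x_{N+1})\subset K[\mathbf{P}^{N+1}]$. Then: (a) Assume $\operatorname{char}(K)=0$. For every integer $r\geq 1$, if $I^{(rN)}\subseteq M^{r(N-1)}I^r$ holds, then $\widehat{I}^{(r(N+1))}\subseteq \widehat{M}^{rN}\widehat{I}^r$ holds. In particular, if the former holds for all $r\ge1$, so does the latter. (b) (Any characteristic.) If $I^{(rN-(N-1))}\subseteq I^r$ holds for all $r\geq 1$, then $\widehat{I}^{(r(N+1)-N)}\subseteq \widehat{I}^{(rN-(N-1))}\subseteq \widehat{I}^r$ holds for all $r\geq 1$. (c) Assume $\operatorname{char}(K)=0$. For every integer $r\geq 1$, if $I^{(rN-(N-1))}\subseteq M^{(r-1)(N-1)}I^r$ holds, then $\widehat{I}^{(r(N+1)-N)}\subseteq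 \widehat{M}^{(r-1)N}\widehat{I}^r$ holds. In particular, if the former holds for all $r\ge1$, so does the latter.
   Context: For a finite set of distinct points $P_1,\ldots,P_n$ in a projective space $\mathbf{P}^d$ over $K$ with radical ideal $J=\bigcap_i I(P_i)$, where $I(P_i)\subset K[\mathbf{P}^d]$ is the ideal generated by all forms vanishing at $P_i$, the $m$-th symbolic power is $J^{(m)}=\bigcap_i I(P_i)^m$. (Here the ideals $I(P_i)$ are taken in $K[\mathbf{P}^N]$ for $I$, and in $K[\mathbf{P}^{N+1}]$ for $\widehat I$.) For any ideal $J$, $J^0$ is the whole ring. *)

theory Defs
  imports
    "HOL-Algebra.Ideal_Product"
    "HOL-Library.Poly_Mapping"
    "HOL-Computational_Algebra.Computational_Algebra"
begin

section \<open>Polynomial rings\<close>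

text \<open>
  Exponent vectors have type \<open>nat \<Rightarrow>\<^sub>0 nat\<close>, so that the following type is the polynomial ring over
  \<open>'k\<close> in the countably many variables \<open>x\<^sub>0, x\<^sub>1, \<dots>\<close>. The ring \<open>K[x\<^sub>i | i \<in> V]\<close> is the subring
  \<open>poly_ring V\<close>, and all ideal-theoretic notions are relative to it.
\<close>

type_synonym 'k mpoly = "(nat \<Rightarrow>\<^sub>0 nat) \<Rightarrow>\<^sub>0 'k"

definition Var :: "nat \<Rightarrow> 'k::comm_ring_1 mpoly"
  where "Var i = Poly_Mapping.single (Poly_Mapping.single i 1) 1"

definition poly_ring :: "nat set \<Rightarrow> 'k::comm_ring_1 mpoly ring"
  where "poly_ring V =
    \<lparr>carrier = {p. \<forall>e \<in> Poly_Mapping.keys p. Poly_Mapping.keys e \<subseteq> V},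
     monoid.mult = (*), one = 1, zero = 0, add = (+)\<rparr>"

definition mpoly_eval :: "(nat \<Rightarrow> 'k) \<Rightarrow> 'k::comm_ring_1 mpoly \<Rightarrow> 'k"
  where "mpoly_eval v p =
    (\<Sum>e \<in> Poly_Mapping.keys p.
       Poly_Mapping.lookup p e * (\<Prod>i \<in> Poly_Mapping.keys e. v i ^ Poly_Mapping.lookup e i))"

definition mono_degree :: "(nat \<Rightarrow>\<^sub>0 nat) \<Rightarrow> nat"
  where "mono_degree e = (\<Sum>i \<in> Poly_Mapping.keys e. Poly_Mapping.lookup e i)"

definition homogeneous :: "'k::comm_ring_1 mpoly \<Rightarrow> bool"
  where "homogeneous p \<longleftrightarrow> (\<exists>d. \<forall>e \<in> Poly_Mapping.keys p. mono_degree e = d)"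

lemma poly_ring_simps:
  "carrier (poly_ring V) = {p. \<forall>e \<in> Poly_Mapping.keys p. Poly_Mapping.keys e \<subseteq> V}"
  "monoid.mult (poly_ring V) = (*)" "one (poly_ring V) = 1"
  "zero (poly_ring V) = 0" "add (poly_ring V) = (+)"
  by (simp_all add: poly_ring_def)

lemma cring_poly_ring: "cring (poly_ring V :: 'k::comm_ring_1 mpoly ring)"
proof (rule cringI)
  let ?R = "poly_ring V :: 'k mpoly ring"
  have add_closed: "p + q \<in> carrier ?R" if "p \<in> carrier ?R" "q \<in> carrier ?R" for p q
    using that Poly_Mapping.keys_add[of p q] by (auto simp: poly_ring_simps)
  have mult_closed: "p * q \<in> carrier ?R" if "p \<in> carrier ?R" "q \<in> carrier ?R" for p q
  proof -
    have "Poly_Mapping.keys e \<subseteq> V" if "e \<in> Poly_Mapping.keys (p * q)" for e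
    proof -
      obtain a b where "e = a + b" "a \<in> Poly_Mapping.keys p" "b \<in> Poly_Mapping.keys q"
        using \<open>e \<in> _\<close> Poly_Mapping.keys_mult[of p q] by blast
      thus ?thesis
        using \<open>p \<in> _\<close> \<open>q \<in> _\<close> Poly_Mapping.keys_add[of a b]
        unfolding poly_ring_simps mem_Collect_eq
        by (metis (no_types) \<open>e = a + b\<close> \<open>a \<in> _\<close> \<open>b \<in> _\<close> Un_least order_trans)
    qed
    thus ?thesis by (auto simp: poly_ring_simps)
  qed
  have uminus_closed: "- p \<in> carrier ?R" if "p \<in> carrier ?R" for p
    using that by (simp add: poly_ring_simps Poly_Mapping.keys_def uminus_poly_mapping.rep_eq)
  show "abelian_group ?R"
  proof (rule abelian_groupI)
    show "p \<oplus>\<^bsub>?R\<^esub> q \<in> carrier ?R" if "p \<in> carrier ?R" "q \<in> carrier ?R" for p q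
      using add_closed[OF that] by (simp add: poly_ring_simps(5))
    show "\<exists>q \<in> carrier ?R. q \<oplus>\<^bsub>?R\<^esub> p = \<zero>\<^bsub>?R\<^esub>" if "p \<in> carrier ?R" for p
      using uminus_closed[OF that] by (intro bexI[of _ "- p"]) (simp_all add: poly_ring_simps)
  qed (simp_all add: poly_ring_simps algebra_simps)
  show "Group.comm_monoid ?R"
  proof (rule comm_monoidI)
    show "p \<otimes>\<^bsub>?R\<^esub> q \<in> carrier ?R" if "p \<in> carrier ?R" "q \<in> carrier ?R" for p q
      using mult_closed[OF that] by (simp add: poly_ring_simps(2))
  qed (simp_all add: poly_ring_simps algebra_simps)
qed (simp_all add: poly_ring_simps algebra_simps)


section \<open>Projective space\<close>

text \<open>
  Homogeneous coordinates are functions on all of \<open>nat\<close> which vanish outside of \<open>V\<close>. With this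
  convention the identification of the hyperplane \<open>x\<^sub>0 = 0\<close> in \<open>P\<^sup>N\<^sup>+\<^sup>1\<close> with the projective space
  with coordinates \<open>x\<^sub>1, \<dots>, x\<^sub>N\<^sub>+\<^sub>1\<close> is an equality of sets.
\<close>

definition cone :: "nat set \<Rightarrow> (nat \<Rightarrow> 'k::field) set"
  where "cone V = {v. (\<forall>i. i \<notin> V \<longrightarrow> v i = 0) \<and> (\<exists>i. v i \<noteq> 0)}"

definition proportional :: "nat set \<Rightarrow> ((nat \<Rightarrow> 'k::field) \<times> (nat \<Rightarrow> 'k)) set"
  where "proportional V =
    {(v, w). v \<in> cone V \<and> w \<in> cone V \<and> (\<exists>c. c \<noteq> 0 \<and> (\<forall>i. w i = c * v i))}"

definition proj_space :: "nat set \<Rightarrow> (nat \<Rightarrow> 'k::field) set set"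
  where "proj_space V = cone V // proportional V"

lemma equiv_proportional: "equiv (cone V) (proportional V :: ((nat \<Rightarrow> 'k::field) \<times> _) set)"
proof (rule equivI)
  show "refl_on (cone V) (proportional V :: ((nat \<Rightarrow> 'k::field) \<times> _) set)"
    by (auto simp: refl_on_def proportional_def intro: exI[of _ 1])
  show "(proportional V :: ((nat \<Rightarrow> 'k::field) \<times> _) set) \<subseteq> cone V \<times> cone V"
    by (auto simp: proportional_def)
  show "sym (proportional V :: ((nat \<Rightarrow> 'k::field) \<times> _) set)"
  proof (rule symI)
    fix v w :: "nat \<Rightarrow> 'k"
    assume "(v, w) \<in> proportional V"
    then obtain c where "v \<in> cone V" "w \<in> cone V" "c \<noteq> 0" "\<forall>i. w i = c * v i"
      by (auto simp: proportional_def)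
    moreover have "\<forall>i. v i = inverse c * w i" "inverse c \<noteq> 0"
      using \<open>c \<noteq> 0\<close> \<open>\<forall>i. w i = c * v i\<close> by (simp_all add: field_simps)
    ultimately show "(w, v) \<in> proportional V" unfolding proportional_def by blast
  qed
  show "trans (proportional V :: ((nat \<Rightarrow> 'k::field) \<times> _) set)"
  proof (rule transI)
    fix u v w :: "nat \<Rightarrow> 'k"
    assume "(u, v) \<in> proportional V" "(v, w) \<in> proportional V"
    then obtain c d where *: "u \<in> cone V" "w \<in> cone V" "c \<noteq> 0" "d \<noteq> 0"
      "\<forall>i. v i = c * u i" "\<forall>i. w i = d * v i"
      by (auto simp: proportional_def)
    hence "\<forall>i. w i = (d * c) * u i" "d * c \<noteq> 0" by simp_all
    with * show "(u, w) \<in> proportional V" unfolding proportional_def by blast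
  qed
qed

definition hyperplane0 :: "nat \<Rightarrow> (nat \<Rightarrow> 'k::field) set set"
  where "hyperplane0 N = {P \<in> proj_space {0..N+1}. \<forall>v \<in> P. v 0 = 0}"

lemma hyperplane0_eq: "hyperplane0 N = (proj_space {1..N+1} :: (nat \<Rightarrow> 'k::field) set set)"
proof -
  have V: "i \<in> {1..N+1} \<longleftrightarrow> i \<in> {0..N+1} \<and> i \<noteq> 0" for i :: nat by auto
  have cone: "v \<in> cone {1..N+1} \<longleftrightarrow> v \<in> cone {0..N+1} \<and> v 0 = 0" for v :: "nat \<Rightarrow> 'k"
    unfolding cone_def V by auto
  have class_eq: "proportional {0..N+1} `` {v} = proportional {1..N+1} `` {v}"
    if "v \<in> cone {1..N+1}" for v :: "nat \<Rightarrow> 'k"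
    using that unfolding proportional_def cone by auto
  have self: "v \<in> proportional V `` {v}" if "v \<in> cone V" for v :: "nat \<Rightarrow> 'k" and V
    using equiv_proportional that by (rule equiv_class_self)
  show ?thesis
  proof (intro equalityI subsetI)
    fix P :: "(nat \<Rightarrow> 'k) set" assume "P \<in> hyperplane0 N"
    then obtain v where v: "v \<in> cone {0..N+1}" "P = proportional {0..N+1} `` {v}" "\<forall>w \<in> P. w 0 = 0"
      by (auto simp: hyperplane0_def proj_space_def elim: quotientE)
    hence "v \<in> cone {1..N+1}" using self cone by blast
    thus "P \<in> proj_space {1..N+1}"
      unfolding proj_space_def using class_eq[OF \<open>v \<in> cone {1..N+1}\<close>] v(2) quotientI by metis
  next
    fix P :: "(nat \<Rightarrow> 'k) set" assume "P \<in> proj_space {1..N+1}"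
    then obtain v where v: "v \<in> cone {1..N+1}" "P = proportional {1..N+1} `` {v}"
      by (auto simp: proj_space_def elim: quotientE)
    hence "v \<in> cone {0..N+1}" "P = proportional {0..N+1} `` {v}"
      using cone class_eq[OF v(1)] v(2) by blast+
    moreover have "\<forall>w \<in> P. w 0 = 0" using v(2) unfolding proportional_def cone by auto
    ultimately show "P \<in> hyperplane0 N"
      unfolding hyperplane0_def proj_space_def by (simp add: quotientI)
  qed
qed


section \<open>Ideals of points\<close>

text \<open>
  Products and powers of ideals are those of the multiplicative monoid of ideals; the unit of
  that monoid is the whole ring, so \<open>J\<^sup>0\<close> is the whole ring.
\<close>

abbreviation ideal_pow :: "'a ring \<Rightarrow> 'a set \<Rightarrow> nat \<Rightarrow> 'a set"
  where "ideal_pow R J m \<equiv> J [^]\<^bsub>ideals_set R\<^esub> m"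

definition point_ideal :: "nat set \<Rightarrow> (nat \<Rightarrow> 'k::field) set \<Rightarrow> 'k mpoly set"
  where "point_ideal V P =
    genideal (poly_ring V)
      {f \<in> carrier (poly_ring V). homogeneous f \<and> (\<forall>v \<in> P. mpoly_eval v f = 0)}"

text \<open>The following two notions are used for nonempty sets of points only.\<close>

definition points_ideal :: "nat set \<Rightarrow> (nat \<Rightarrow> 'k::field) set set \<Rightarrow> 'k mpoly set"
  where "points_ideal V Z = (\<Inter>P \<in> Z. point_ideal V P)"

definition symbolic_power ::
    "nat set \<Rightarrow> (nat \<Rightarrow> 'k::field) set set \<Rightarrow> nat \<Rightarrow> 'k mpoly set"
  where "symbolic_power V Z m = (\<Inter>P \<in> Z. ideal_pow (poly_ring V) (point_ideal V P) m)"

definition irrelevant_ideal :: "nat set \<Rightarrow> 'k::field mpoly set"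
  where "irrelevant_ideal V = genideal (poly_ring V) (Var ` V)"

end

theory Submission
  imports Defs
begin

text \<open>
  If \<open>f\<close> lies in the \<open>m\<close>-th symbolic power for the ambient space, then the coefficient of \<open>x\<^sub>0^i\<close>
  in \<open>f\<close> lies in \<open>I^(m - i)\<close>, where \<open>I^(m)\<close> is the symbolic power. As \<open>x\<^sub>0\<close> belongs to both the
  ideal of the points and the irrelevant ideal of the ambient space, everything can be checked
  coefficientwise; this gives (b) at once. For (a) and (c), write the two symbolic exponents as
  \<open>t + r\<close> and \<open>t + r + u\<close>, where \<open>r \<le> u + 1\<close>. For \<open>i \<le> u\<close>, partial derivatives map \<open>I^(m + 1)\<close>
  into \<open>I^(m)\<close>, so in characteristic 0 Euler's identity turns the hypothesis that \<open>I^(t + r)\<close> is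
  contained in \<open>M^t I^r\<close> into the containment of \<open>I^(t + r + k)\<close> in \<open>M^(t + k) I^r\<close>. For \<open>i > u\<close>, the
  factor \<open>x\<^sub>0^r\<close> accounts for the \<open>r\<close>-th power of the ideal of the points, and the containment of
  \<open>I^(m)\<close> in \<open>M^m\<close> suffices for the rest.
\<close>

section \<open>Ideals of polynomial rings\<close>

text \<open>Closure under negation comes from multiplication by the ring element -1.\<close>

lemma ideal_poly_ringI:
  fixes A :: "'k::comm_ring_1 mpoly set"
  assumes "A \<subseteq> carrier (poly_ring V)" "0 \<in> A"
    and "\<And>a b. a \<in> A \<Longrightarrow> b \<in> A \<Longrightarrow> a + b \<in> A"
    and "\<And>a x. a \<in> A \<Longrightarrow> x \<in> carrier (poly_ring V) \<Longrightarrow> x * a \<in> A"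
  shows "ideal A (poly_ring V)"
proof -
  interpret cring "poly_ring V :: 'k mpoly ring" by (rule cring_poly_ring)
  have minus: "- a \<in> A" if "a \<in> A" for a
  proof -
    have "- 1 \<in> carrier (poly_ring V :: 'k mpoly ring)"
      by (simp add: poly_ring_simps)
    from assms(4)[OF that this] show ?thesis by simp
  qed
  have inv: "inv\<^bsub>add_monoid (poly_ring V)\<^esub> a = - a" if "a \<in> A" for a :: "'k mpoly"
    unfolding a_inv_def[symmetric]
    by (rule minus_equality) (use minus[OF that] that assms(1) in \<open>auto simp: poly_ring_simps(4,5)\<close>)
  show ?thesis
  proof (rule idealI)
    show "subgroup A (add_monoid (poly_ring V))"
    proof
      show "inv\<^bsub>add_monoid (poly_ring V)\<^esub> x \<in> A" if "x \<in> A" for x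
        using minus[OF that] inv[OF that] by simp
      show "x \<otimes>\<^bsub>add_monoid (poly_ring V)\<^esub> y \<in> A" if "x \<in> A" "y \<in> A" for x y
        using assms(3)[OF that] by (simp add: poly_ring_simps)
    qed (use assms(1,2) in \<open>auto simp: poly_ring_simps(4)\<close>)
  qed (use assms(4) in \<open>auto simp: poly_ring_simps(2) mult.commute ring_axioms\<close>)
qed

context
  fixes A :: "'k::comm_ring_1 mpoly set" and V
  assumes A: "ideal A (poly_ring V)"
begin

lemma poly_ideal_subset: "A \<subseteq> carrier (poly_ring V)"
  using ideal.Icarr[OF A] by blast

lemma poly_ideal_zero: "0 \<in> A"
  using additive_subgroup.zero_closed[OF ideal.axioms(1)[OF A]] by (simp add: poly_ring_simps)

lemma poly_ideal_add: "a \<in> A \<Longrightarrow> b \<in> A \<Longrightarrow> a + b \<in> A"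
  using additive_subgroup.a_closed[OF ideal.axioms(1)[OF A], of a b] by (simp add: poly_ring_simps)

lemma poly_ideal_mult: "x \<in> carrier (poly_ring V) \<Longrightarrow> a \<in> A \<Longrightarrow> x * a \<in> A"
  using ideal.I_l_closed[OF A, of a x] by (simp add: poly_ring_simps)

lemma poly_ideal_sum: "(\<And>i. i \<in> X \<Longrightarrow> f i \<in> A) \<Longrightarrow> sum f X \<in> A"
  by (induction X rule: infinite_finite_induct) (auto intro: poly_ideal_zero poly_ideal_add)

end

text \<open>The unit ideal; closure properties of the ring become instances of those of
  ideals.\<close>

lemma ideal_carrier_poly_ring: "ideal (carrier (poly_ring V)) (poly_ring V :: 'k::comm_ring_1 mpoly ring)"
  by (rule ring.oneideal[OF cring.axioms(1)[OF cring_poly_ring]])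

lemmas poly_ring_add = poly_ideal_add[OF ideal_carrier_poly_ring]
  and poly_ring_mult = poly_ideal_mult[OF ideal_carrier_poly_ring]

lemma poly_ring_zero: "0 \<in> carrier (poly_ring V)"
  and poly_ring_one: "1 \<in> carrier (poly_ring V)"
  and poly_ring_single: "Poly_Mapping.keys e \<subseteq> V \<Longrightarrow> Poly_Mapping.single e c \<in> carrier (poly_ring V)"
  and poly_ring_Var: "i \<in> V \<Longrightarrow> Var i \<in> carrier (poly_ring V)"
  by (simp_all add: poly_ring_simps Var_def)

lemma poly_ring_mono: "V \<subseteq> W \<Longrightarrow> carrier (poly_ring V) \<subseteq> carrier (poly_ring W)"
  by (auto simp: poly_ring_simps)

lemma ideal_genideal_poly_ring:
  "X \<subseteq> carrier (poly_ring V) \<Longrightarrow> ideal (genideal (poly_ring V) X) (poly_ring V :: 'k::comm_ring_1 mpoly ring)"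
  by (rule ring.genideal_ideal[OF cring.axioms(1)[OF cring_poly_ring]])

lemma genideal_poly_ring_minimal:
  "ideal A (poly_ring V :: 'k::comm_ring_1 mpoly ring) \<Longrightarrow> X \<subseteq> A \<Longrightarrow> genideal (poly_ring V) X \<subseteq> A"
  by (rule ring.genideal_minimal[OF cring.axioms(1)[OF cring_poly_ring]])

lemma genideal_poly_ring_self: "x \<in> X \<Longrightarrow> x \<in> genideal (poly_ring V) X"
  by (auto simp: genideal_def)

text \<open>The contraction of the larger ideal to the smaller ring is an ideal there and contains
  \<open>X\<close>.\<close>

lemma genideal_poly_ring_mono:
  fixes X Y :: "'k::comm_ring_1 mpoly set"
  assumes "V \<subseteq> W" "X \<subseteq> Y" "X \<subseteq> carrier (poly_ring V)" "Y \<subseteq> carrier (poly_ring W)"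
  shows "genideal (poly_ring V) X \<subseteq> genideal (poly_ring W) Y"
proof -
  let ?B = "genideal (poly_ring W) Y" and ?R = "carrier (poly_ring V :: 'k mpoly ring)"
  have B: "ideal ?B (poly_ring W)" by (rule ideal_genideal_poly_ring[OF assms(4)])
  have "ideal (?B \<inter> ?R) (poly_ring V)"
  proof (rule ideal_poly_ringI)
    show "x * a \<in> ?B \<inter> ?R" if "a \<in> ?B \<inter> ?R" "x \<in> ?R" for a x
      using that poly_ring_mono[OF assms(1)] poly_ideal_mult[OF B, of x a] by (auto intro: poly_ring_mult)
  qed (auto intro: poly_ideal_zero[OF B] poly_ring_zero poly_ideal_add[OF B] poly_ring_add)
  moreover have "X \<subseteq> ?B \<inter> ?R" using assms(2,3) genideal_poly_ring_self by blast
  ultimately show ?thesis using genideal_poly_ring_minimal by blast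
qed

section \<open>Products and powers of ideals\<close>

lemma ideal_prodI: "a \<in> A \<Longrightarrow> b \<in> B \<Longrightarrow> a * b \<in> ideal_prod (poly_ring V) A B"
  using ideal_prod.prod[of a A b B "poly_ring V"] by (simp add: poly_ring_simps)

lemma ideal_prod_poly_induct [consumes 1, case_names prod sum]:
  assumes "x \<in> ideal_prod (poly_ring V) A B"
    and "\<And>a b. a \<in> A \<Longrightarrow> b \<in> B \<Longrightarrow> P (a * b)"
    and "\<And>x y. P x \<Longrightarrow> P y \<Longrightarrow> P (x + y)"
  shows "P x"
  using assms(1)
  by (induction rule: ideal_prod.induct) (auto simp: poly_ring_simps intro: assms(2,3))

lemma ideal_ideal_prod:
  fixes A B :: "'k::comm_ring_1 mpoly set"
  shows "ideal A (poly_ring V) \<Longrightarrow> ideal B (poly_ring V) \<Longrightarrow> ideal (ideal_prod (poly_ring V) A B) (poly_ring V)"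
  by (rule ring.ideal_prod_is_ideal[OF cring.axioms(1)[OF cring_poly_ring]])

lemma ideal_prod_poly_mono:
  assumes "A \<subseteq> A'" "B \<subseteq> B'"
  shows "ideal_prod (poly_ring V) A B \<subseteq> ideal_prod (poly_ring W) A' B'"
proof
  fix x assume "x \<in> ideal_prod (poly_ring V) A B"
  then show "x \<in> ideal_prod (poly_ring W) A' B'"
  proof (induction rule: ideal_prod_poly_induct)
    case (sum x y)
    then show ?case using ideal_prod.sum[of x "poly_ring W" A' B' y] by (simp add: poly_ring_simps)
  qed (use assms ideal_prodI in blast)
qed

lemma ideal_pow_0: "ideal_pow (poly_ring V) A 0 = carrier (poly_ring V)"
  by (simp add: ideals_set_def)

lemma ideal_pow_Suc: "ideal_pow (poly_ring V) A (Suc m) = ideal_prod (poly_ring V) (ideal_pow (poly_ring V) A m) A"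
  by (simp add: ideals_set_def)

lemma ideal_pow_mono:
  assumes "V \<subseteq> W" "A \<subseteq> B"
  shows "ideal_pow (poly_ring V) A m \<subseteq> ideal_pow (poly_ring W) B m"
proof (induction m)
  case 0 then show ?case using poly_ring_mono[OF assms(1)] by (simp only: ideal_pow_0)
next
  case (Suc m) then show ?case unfolding ideal_pow_Suc by (rule ideal_prod_poly_mono[OF _ assms(2)])
qed

context
  fixes A :: "'k::comm_ring_1 mpoly set" and V
  assumes A: "ideal A (poly_ring V)"
begin

lemma ideal_ideal_pow: "ideal (ideal_pow (poly_ring V) A m) (poly_ring V)"
  by (induction m) (simp_all only: ideal_pow_0 ideal_pow_Suc ideal_ideal_prod A ideal_carrier_poly_ring)

lemma ideal_pow_mult:
  assumes "a \<in> ideal_pow (poly_ring V) A m" "b \<in> ideal_pow (poly_ring V) A n"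
  shows "a * b \<in> ideal_pow (poly_ring V) A (m + n)"
proof -
  have "monoid (ideals_set (poly_ring V :: 'k mpoly ring))"
    using cring.ideals_set_is_comm_monoid[OF cring_poly_ring] by (rule comm_monoid.axioms(1))
  moreover have "A \<in> carrier (ideals_set (poly_ring V))" using A by (simp add: ideals_set_def)
  ultimately have "ideal_prod (poly_ring V) (ideal_pow (poly_ring V) A m) (ideal_pow (poly_ring V) A n)
      = ideal_pow (poly_ring V) A (m + n)"
    using monoid.nat_pow_mult[of "ideals_set (poly_ring V)" A m n] by (simp add: ideals_set_def)
  then show ?thesis using ideal_prodI[OF assms, of V] by simp
qed

text \<open>The recursion makes the first power the product of the whole ring with \<open>A\<close>,
  so this is the unit law for ideals.\<close>

lemma ideal_pow_1: "ideal_pow (poly_ring V) A (Suc 0) = A"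
proof -
  have R: "cring (poly_ring V :: 'k mpoly ring)" by (rule cring_poly_ring)
  show ?thesis unfolding ideal_pow_Suc ideal_pow_0
    using cring.ideal_prod_commute[OF R ideal_carrier_poly_ring A]
      ring.ideal_prod_one[OF cring.axioms(1)[OF R] A] by simp
qed

lemma ideal_pow_antimono:
  assumes "m \<le> n"
  shows "ideal_pow (poly_ring V) A n \<subseteq> ideal_pow (poly_ring V) A m"
  using assms
proof (induction rule: dec_induct)
  case (step n)
  have "ideal_pow (poly_ring V) A (Suc n) \<subseteq> ideal_pow (poly_ring V) A n"
    using ring.ideal_prod_inter[OF cring.axioms(1)[OF cring_poly_ring] ideal_ideal_pow A, of n]
    unfolding ideal_pow_Suc by blast
  then show ?case using step.IH by blast
qed simp

lemma power_in_ideal_pow: "a \<in> A \<Longrightarrow> a ^ m \<in> ideal_pow (poly_ring V) A m"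
proof (induction m)
  case (Suc m)
  then show ?case unfolding ideal_pow_Suc by (simp only: power_Suc2 ideal_prodI)
qed (simp add: ideal_pow_0 poly_ring_one del: Group.nat_pow_0)

end

section \<open>Weight components and the Euler operators\<close>

text \<open>A polynomial is the sum of its terms. The single case meets only exponents of
  \<open>p\<close>, which carries side conditions on \<open>p\<close> into the induction.\<close>

lemma poly_mapping_keys_induct [case_names zero single add]:
  fixes p :: "'a \<Rightarrow>\<^sub>0 'b::comm_monoid_add"
  assumes "P 0" "\<And>e c. e \<in> Poly_Mapping.keys p \<Longrightarrow> P (Poly_Mapping.single e c)"
    and "\<And>p q. P p \<Longrightarrow> P q \<Longrightarrow> P (p + q)"
  shows "P p"
proof -
  have "p = (\<Sum>e\<in>Poly_Mapping.keys p. Poly_Mapping.single e (Poly_Mapping.lookup p e))"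
    by (rule poly_mapping_eqI)
      (simp add: lookup_sum lookup_single when_def in_keys_iff)
  moreover have "P (\<Sum>e\<in>X. Poly_Mapping.single e (Poly_Mapping.lookup p e))"
    if "X \<subseteq> Poly_Mapping.keys p" for X
    using finite_subset[OF that finite_keys] that by (induction X rule: finite_induct) (auto intro: assms)
  ultimately show ?thesis by (metis order_refl)
qed

text \<open>The weight is a parameter because two gradings are used: the total degree, for Euler's
  identity and constant terms, and the exponent of x_0, for the passage from the hyperplane to the
  ambient space.\<close>

definition weight_comp :: "((nat \<Rightarrow>\<^sub>0 nat) \<Rightarrow> nat) \<Rightarrow> nat \<Rightarrow> 'k::comm_ring_1 mpoly \<Rightarrow> 'k mpoly"
  where "weight_comp w d = Poly_Mapping.mapp (\<lambda>e c. c when w e = d)"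

lemma lookup_weight_comp: "Poly_Mapping.lookup (weight_comp w d p) e = (Poly_Mapping.lookup p e when w e = d)"
  by (simp add: weight_comp_def lookup_mapp when_def in_keys_iff)

lemma keys_weight_comp: "Poly_Mapping.keys (weight_comp w d p) = {e \<in> Poly_Mapping.keys p. w e = d}"
  by (auto simp: in_keys_iff lookup_weight_comp)

lemma weight_comp_zero: "weight_comp w d 0 = 0"
  and weight_comp_add: "weight_comp w d (p + q) = weight_comp w d p + weight_comp w d q"
  and weight_comp_single: "weight_comp w d (Poly_Mapping.single e c) = (Poly_Mapping.single e c when w e = d)"
  by (rule poly_mapping_eqI; simp add: lookup_weight_comp lookup_add lookup_single when_def)+

lemma weight_comp_in_poly_ring: "p \<in> carrier (poly_ring V) \<Longrightarrow> weight_comp w d p \<in> carrier (poly_ring V)"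
  by (auto simp: poly_ring_simps keys_weight_comp)

lemma sum_weight_comp: "(\<Sum>d\<in>w ` Poly_Mapping.keys p. weight_comp w d p) = p"
proof (rule poly_mapping_eqI)
  fix e
  show "Poly_Mapping.lookup (\<Sum>d\<in>w ` Poly_Mapping.keys p. weight_comp w d p) e = Poly_Mapping.lookup p e"
    by (cases "e \<in> Poly_Mapping.keys p") (auto simp: lookup_sum lookup_weight_comp when_def in_keys_iff)
qed

text \<open>Both sides are biadditive, so monomials suffice; for these only the index
  \<open>i = w e\<close> can contribute.\<close>

lemma weight_comp_mult:
  assumes w: "\<And>e e'. w (e + e') = w e + w e'"
  shows "weight_comp w d (p * q) = (\<Sum>i\<le>d. weight_comp w i p * weight_comp w (d - i) q)"
proof (induction p rule: poly_mapping_keys_induct)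
  case (single e c)
  show ?case
  proof (induction q rule: poly_mapping_keys_induct)
    case (single e' c')
    have "(\<Sum>i\<le>d. weight_comp w i (Poly_Mapping.single e c) * weight_comp w (d - i) (Poly_Mapping.single e' c')) =
      (\<Sum>i\<le>d. if i = w e then (Poly_Mapping.single (e + e') (c * c') when w e' = d - w e) else 0)"
      by (rule sum.cong) (auto simp: weight_comp_single when_def mult_single)
    also have "\<dots> = weight_comp w d (Poly_Mapping.single e c * Poly_Mapping.single e' c')"
      by (auto simp: mult_single weight_comp_single when_def w)
    finally show ?case ..
  qed (simp_all add: weight_comp_zero weight_comp_add algebra_simps sum.distrib)
qed (simp_all add: weight_comp_zero weight_comp_add algebra_simps sum.distrib)

text \<open>
  \<open>x\<^sub>k \<partial>/\<partial>x\<^sub>k\<close> is used instead of \<open>\<partial>/\<partial>x\<^sub>k\<close>, since it does not shift exponents; the factor \<open>x\<^sub>k\<close> is cancelled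
  afterwards.
\<close>

definition euler :: "nat \<Rightarrow> 'k::comm_ring_1 mpoly \<Rightarrow> 'k mpoly"
  where "euler k = Poly_Mapping.mapp (\<lambda>e c. of_nat (Poly_Mapping.lookup e k) * c)"

lemma lookup_euler:
  "Poly_Mapping.lookup (euler k p) e = of_nat (Poly_Mapping.lookup e k) * Poly_Mapping.lookup p e"
  by (simp add: euler_def lookup_mapp when_def in_keys_iff)

lemma euler_zero: "euler k 0 = 0"
  and euler_add: "euler k (p + q) = euler k p + euler k q"
  and euler_single: "euler k (Poly_Mapping.single e c) =
    Poly_Mapping.single e (of_nat (Poly_Mapping.lookup e k) * c)"
  by (rule poly_mapping_eqI; simp add: lookup_euler lookup_add lookup_single when_def algebra_simps)+

text \<open>The product rule: by biadditivity it reduces to monomials, whose exponents add.\<close>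

lemma euler_mult: "euler k (p * q) = euler k p * q + p * euler k q"
proof (induction p rule: poly_mapping_keys_induct)
  case (single e c)
  show ?case
    by (induction q rule: poly_mapping_keys_induct)
      (simp_all add: euler_zero euler_add euler_single mult_single lookup_add algebra_simps
        flip: single_add)
qed (simp_all add: euler_zero euler_add algebra_simps)

text \<open>Euler's identity: \<open>euler k\<close> scales a monomial by its exponent at
  \<open>k\<close>, and the exponents over \<open>V\<close> sum to the degree.\<close>

lemma sum_euler_weight_comp:
  assumes "p \<in> carrier (poly_ring V)" "finite V"
  shows "(\<Sum>k\<in>V. euler k (weight_comp mono_degree d p)) = Poly_Mapping.single 0 (of_nat d) * weight_comp mono_degree d p"
proof (rule poly_mapping_eqI)
  fix e :: "nat \<Rightarrow>\<^sub>0 nat"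
  have l: "Poly_Mapping.lookup (Poly_Mapping.single 0 c * q) e = c * Poly_Mapping.lookup q e" for c :: 'a and q :: "'a mpoly"
    unfolding mult_map_scale_conv_mult[symmetric] by (simp add: Poly_Mapping.map.rep_eq when_def)
  show "Poly_Mapping.lookup (\<Sum>k\<in>V. euler k (weight_comp mono_degree d p)) e =
    Poly_Mapping.lookup (Poly_Mapping.single 0 (of_nat d) * weight_comp mono_degree d p) e"
  proof (cases "e \<in> Poly_Mapping.keys p \<and> mono_degree e = d")
    case True
    then have "Poly_Mapping.keys e \<subseteq> V" using assms(1) by (auto simp: poly_ring_simps)
    then have "(\<Sum>k\<in>V. Poly_Mapping.lookup e k) = mono_degree e"
      unfolding mono_degree_def using assms(2) by (intro sum.mono_neutral_right) (auto simp: in_keys_iff)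
    with True have "(\<Sum>k\<in>V. of_nat (Poly_Mapping.lookup e k)) = (of_nat d :: 'a)"
      by (metis of_nat_sum)
    with True show ?thesis
      by (simp add: l lookup_sum lookup_euler lookup_weight_comp flip: sum_distrib_right del: single_of_nat)
  next
    case False
    then show ?thesis by (auto simp: l lookup_sum lookup_euler lookup_weight_comp in_keys_iff when_def simp del: single_of_nat)
  qed
qed

section \<open>Monomials and powers of variables\<close>

lemma Var_power: "Var k ^ i = Poly_Mapping.single (Poly_Mapping.single k i) 1"
  by (induction i) (simp_all add: Var_def mult_single flip: single_add)

text \<open>Over a field this allows \<open>Var k ^ i\<close> to be cancelled, so a cofactor
  \<open>g\<close> in \<open>Var k ^ i * g\<close> is unique.\<close>

lemma Var_power_nonzero: "Var k ^ i \<noteq> (0 :: 'k::comm_ring_1 mpoly)"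
  by (metis Var_power lookup_single_eq lookup_zero zero_neq_one)

lemma single_eq_Var_power_mult:
  assumes "i \<le> Poly_Mapping.lookup e k"
  shows "Poly_Mapping.single e c = Var k ^ i * Poly_Mapping.single (e - Poly_Mapping.single k i) c"
proof -
  have "e = Poly_Mapping.single k i + (e - Poly_Mapping.single k i)"
    using assms by (intro poly_mapping_eqI) (auto simp: lookup_add lookup_minus lookup_single when_def)
  then show ?thesis by (simp add: Var_power mult_single)
qed

lemma keys_diff_subset: "Poly_Mapping.keys (e - e') \<subseteq> Poly_Mapping.keys (e :: nat \<Rightarrow>\<^sub>0 nat)"
  by (auto simp: in_keys_iff lookup_minus)

lemma mono_degree_add: "mono_degree (e + e') = mono_degree e + mono_degree e'"
  unfolding mono_degree_def by (rule setsum_keys_plus_distrib) auto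

lemma mono_degree_eq_0_iff: "mono_degree e = 0 \<longleftrightarrow> e = 0"
proof
  show "e = 0" if "mono_degree e = 0"
    using that by (intro poly_mapping_eqI) (auto simp: mono_degree_def in_keys_iff)
qed (simp add: mono_degree_def)

text \<open>Products of graded ideals are graded: a component of \<open>a * b\<close> is a sum of
  products of components of \<open>a\<close> and \<open>b\<close>.\<close>

lemma weight_comp_ideal_prod:
  assumes w: "\<And>e e'. w (e + e') = w e + w e'"
    and ideals: "ideal A (poly_ring V)" "ideal B (poly_ring V)"
    and A: "\<And>f d. f \<in> A \<Longrightarrow> weight_comp w d f \<in> A"
    and B: "\<And>f d. f \<in> B \<Longrightarrow> weight_comp w d f \<in> B"
    and f: "f \<in> ideal_prod (poly_ring V) A B"
  shows "weight_comp w d f \<in> ideal_prod (poly_ring V) A B"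
  using f
proof (induction rule: ideal_prod_poly_induct)
  case (prod a b)
  then show ?case
    by (auto simp: weight_comp_mult[of w, OF w] intro!: poly_ideal_sum[OF ideal_ideal_prod[OF ideals]] ideal_prodI A B)
qed (simp add: weight_comp_add poly_ideal_add[OF ideal_ideal_prod[OF ideals]])

lemma weight_comp_ideal_pow:
  assumes w: "\<And>e e'. w (e + e') = w e + w e'"
    and I: "ideal A (poly_ring V)"
    and A: "\<And>f d. f \<in> A \<Longrightarrow> weight_comp w d f \<in> A"
    and f: "f \<in> ideal_pow (poly_ring V) A m"
  shows "weight_comp w d f \<in> ideal_pow (poly_ring V) A m"
  using f
proof (induction m arbitrary: f d)
  case 0
  then show ?case by (simp only: ideal_pow_0 weight_comp_in_poly_ring)
next
  case (Suc m)
  show ?case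
    using Suc.prems unfolding ideal_pow_Suc
    by (rule weight_comp_ideal_prod[rotated -1]) (use w I A Suc.IH in \<open>auto intro: ideal_ideal_pow\<close>)
qed

text \<open>The cofactor \<open>g\<close> is the partial derivative by x_k: terms free of x_k are
  killed, and the others are divisible by it.\<close>

lemma euler_in_poly_ring:
  assumes "f \<in> carrier (poly_ring V)"
  shows "\<exists>g\<in>carrier (poly_ring V). euler k f = Var k * g"
proof (induction f rule: poly_mapping_keys_induct)
  case zero
  show ?case using poly_ring_zero by (intro bexI[of _ 0]) (simp_all add: euler_zero)
next
  case (single e c)
  show ?case
  proof (cases "Poly_Mapping.lookup e k = 0")
    case True
    then show ?thesis using poly_ring_zero by (intro bexI[of _ 0]) (simp_all add: euler_single)
  next
    case False
    have "Poly_Mapping.keys (e - Poly_Mapping.single k 1) \<subseteq> V"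
      using single assms keys_diff_subset by (fastforce simp: poly_ring_simps)
    moreover have "euler k (Poly_Mapping.single e c) = Var k *
        Poly_Mapping.single (e - Poly_Mapping.single k 1) (of_nat (Poly_Mapping.lookup e k) * c)"
      using False single_eq_Var_power_mult[of 1 e k] by (simp add: euler_single)
    ultimately show ?thesis using poly_ring_single by blast
  qed
next
  case (add p q)
  then show ?case by (metis euler_add distrib_left poly_ring_add)
qed

text \<open>A derivative lowers the power of an ideal by at most one. For a product
  \<open>a * b\<close> with \<open>b\<close> in \<open>A\<close>, the product rule leaves either
  \<open>b\<close> or \<open>a\<close> intact, and the induction hypothesis treats the derivative of
  \<open>a\<close>.\<close>

lemma euler_ideal_pow:
  assumes A: "ideal A (poly_ring V)"
    and f: "f \<in> ideal_pow (poly_ring V) A (Suc m)"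
  shows "\<exists>g\<in>ideal_pow (poly_ring V) A m. euler k f = Var k * g"
  using f
proof (induction m arbitrary: f)
  case 0
  then show ?case unfolding ideal_pow_1[OF A] ideal_pow_0
    using euler_in_poly_ring poly_ideal_subset[OF A] by blast
next
  case (Suc m)
  from Suc.prems show ?case unfolding ideal_pow_Suc[of V A "Suc m"]
  proof (induction rule: ideal_prod_poly_induct)
    case (prod a b)
    obtain g where g: "g \<in> ideal_pow (poly_ring V) A m" "euler k a = Var k * g"
      using Suc.IH prod(1) by blast
    obtain h where h: "h \<in> carrier (poly_ring V)" "euler k b = Var k * h"
      using euler_in_poly_ring poly_ideal_subset[OF A] prod(2) by blast
    have "g * b \<in> ideal_pow (poly_ring V) A (Suc m)"
      unfolding ideal_pow_Suc using g(1) prod(2) by (rule ideal_prodI)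
    moreover have "h * a \<in> ideal_pow (poly_ring V) A (Suc m)"
      using h(1) prod(1) by (rule poly_ideal_mult[OF ideal_ideal_pow[OF A]])
    ultimately have "g * b + h * a \<in> ideal_pow (poly_ring V) A (Suc m)"
      by (rule poly_ideal_add[OF ideal_ideal_pow[OF A]])
    moreover have "euler k (a * b) = Var k * (g * b + h * a)"
      by (simp add: euler_mult g h algebra_simps)
    ultimately show ?case by blast
  next
    case (sum x y)
    then show ?case by (metis euler_add distrib_left poly_ideal_add[OF ideal_ideal_pow[OF A]])
  qed
qed

section \<open>Ideals of points and their symbolic powers\<close>

lemma ideal_point_ideal: "ideal (point_ideal V P) (poly_ring V)"
  unfolding point_ideal_def by (rule ideal_genideal_poly_ring) auto

text \<open>An empty \<open>Z\<close> is excluded because its intersection is the whole type, which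
  may exceed the carrier.\<close>

lemma ideal_INT:
  assumes "Z \<noteq> {}" and F: "\<And>P. P \<in> Z \<Longrightarrow> ideal (F P) (poly_ring V)"
  shows "ideal (\<Inter>P\<in>Z. F P) (poly_ring V)"
proof (rule ideal_poly_ringI)
  show "(\<Inter>P\<in>Z. F P) \<subseteq> carrier (poly_ring V)" using assms(1) poly_ideal_subset[OF F] by blast
  show "0 \<in> (\<Inter>P\<in>Z. F P)" using poly_ideal_zero[OF F] by blast
  show "a + b \<in> (\<Inter>P\<in>Z. F P)" if "a \<in> (\<Inter>P\<in>Z. F P)" "b \<in> (\<Inter>P\<in>Z. F P)" for a b
    using that poly_ideal_add[OF F] by blast
  show "x * a \<in> (\<Inter>P\<in>Z. F P)" if "a \<in> (\<Inter>P\<in>Z. F P)" "x \<in> carrier (poly_ring V)" for a x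
    using that poly_ideal_mult[OF F] by blast
qed

lemma ideal_points_ideal: "Z \<noteq> {} \<Longrightarrow> ideal (points_ideal V Z) (poly_ring V)"
  unfolding points_ideal_def by (rule ideal_INT[OF _ ideal_point_ideal])

lemma ideal_symbolic_power: "Z \<noteq> {} \<Longrightarrow> ideal (symbolic_power V Z m) (poly_ring V)"
  unfolding symbolic_power_def by (rule ideal_INT[OF _ ideal_ideal_pow[OF ideal_point_ideal]])

lemma ideal_irrelevant_ideal: "ideal (irrelevant_ideal V) (poly_ring V)"
  unfolding irrelevant_ideal_def by (rule ideal_genideal_poly_ring) (auto intro: poly_ring_Var)

lemma Var_in_irrelevant_ideal: "i \<in> V \<Longrightarrow> Var i \<in> irrelevant_ideal V"
  unfolding irrelevant_ideal_def by (rule genideal_poly_ring_self) (rule imageI)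

lemma symbolic_power_antimono: "m \<le> n \<Longrightarrow> symbolic_power V Z n \<subseteq> symbolic_power V Z m"
  unfolding symbolic_power_def by (intro INF_mono) (auto dest: ideal_pow_antimono[OF ideal_point_ideal])

text \<open>The elements with all components in the ideal form an ideal themselves. It contains the
  generators, since a component of a form is the form or 0.\<close>

lemma weight_comp_point_ideal:
  assumes "f \<in> point_ideal V P"
  shows "weight_comp mono_degree d f \<in> point_ideal V P"
proof -
  let ?W = "{f \<in> carrier (poly_ring V). \<forall>d. weight_comp mono_degree d f \<in> point_ideal V P}"
  note I = ideal_point_ideal[of V P]
  have "ideal ?W (poly_ring V)"
  proof (rule ideal_poly_ringI)
    show "x * a \<in> ?W" if "a \<in> ?W" "x \<in> carrier (poly_ring V)" for a x
      using that
      by (auto simp: weight_comp_mult[of mono_degree, OF mono_degree_add]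
          intro!: poly_ring_mult poly_ideal_sum[OF I] poly_ideal_mult[OF I] weight_comp_in_poly_ring)
  qed (auto simp: weight_comp_zero weight_comp_add poly_ring_zero poly_ring_add
      poly_ideal_zero[OF I] poly_ideal_add[OF I])
  moreover have "weight_comp mono_degree d f = f \<or> weight_comp mono_degree d f = 0"
    if "homogeneous f" for f :: "'a mpoly" and d
  proof -
    from that obtain d' where d': "\<forall>e \<in> Poly_Mapping.keys f. mono_degree e = d'"
      by (auto simp: homogeneous_def)
    show ?thesis
    proof (cases "d = d'")
      case True
      with d' have "weight_comp mono_degree d f = f"
        by (intro poly_mapping_eqI) (auto simp: lookup_weight_comp when_def in_keys_iff)
      then show ?thesis ..
    next
      case False
      with d' have "weight_comp mono_degree d f = 0"
        by (intro poly_mapping_eqI) (auto simp: lookup_weight_comp when_def in_keys_iff)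
      then show ?thesis ..
    qed
  qed
  then have "{f \<in> carrier (poly_ring V). homogeneous f \<and> (\<forall>v \<in> P. mpoly_eval v f = 0)} \<subseteq> ?W"
    using poly_ideal_zero[OF I] genideal_poly_ring_self unfolding point_ideal_def
    by (smt (verit, ccfv_SIG) mem_Collect_eq subsetI)
  ultimately have "point_ideal V P \<subseteq> ?W"
    unfolding point_ideal_def[of V P] by (rule genideal_poly_ring_minimal)
  with assms show ?thesis by blast
qed

lemma weight_comp_symbolic_power:
  "f \<in> symbolic_power V Z m \<Longrightarrow> weight_comp mono_degree d f \<in> symbolic_power V Z m"
  unfolding symbolic_power_def
  by (auto intro: weight_comp_ideal_pow[OF mono_degree_add ideal_point_ideal weight_comp_point_ideal])

lemma euler_symbolic_power:
  assumes "Z \<noteq> {}" "f \<in> symbolic_power V Z (Suc m)"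
  shows "\<exists>g\<in>symbolic_power V Z m. euler k f = Var k * g"
proof -
  have *: "\<exists>g\<in>ideal_pow (poly_ring V) (point_ideal V P) m. euler k f = Var k * g" if "P \<in> Z" for P
    by (rule euler_ideal_pow[OF ideal_point_ideal]) (use assms(2) that in \<open>simp add: symbolic_power_def\<close>)
  \<comment> \<open>The cofactor found for one point serves for all of them, because
    \<open>Var k\<close> can be cancelled.\<close>
  obtain g where g: "euler k f = Var k * g" using assms(1) * by blast
  have "g \<in> ideal_pow (poly_ring V) (point_ideal V P) m" if "P \<in> Z" for P
    using *[OF that] g Var_power_nonzero[of k 1] by auto
  then show ?thesis using g unfolding symbolic_power_def by blast
qed

text \<open>Without a constant term, every monomial is divisible by some variable of
  \<open>V\<close>.\<close>

lemma in_irrelevant_idealI: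
  assumes "f \<in> carrier (poly_ring V)" "weight_comp mono_degree 0 f = 0"
  shows "f \<in> irrelevant_ideal V"
proof (induction f rule: poly_mapping_keys_induct)
  case (single e c)
  have "Poly_Mapping.lookup (weight_comp mono_degree 0 f) 0 = 0" using assms(2) by simp
  with single have "e \<noteq> 0"
    by (auto simp: lookup_weight_comp when_def mono_degree_eq_0_iff in_keys_iff)
  then obtain k where k: "k \<in> Poly_Mapping.keys e" by fastforce
  have V: "Poly_Mapping.keys e \<subseteq> V" using single assms(1) by (auto simp: poly_ring_simps)
  then have "Var k \<in> irrelevant_ideal V" using k Var_in_irrelevant_ideal by blast
  moreover have "Poly_Mapping.single (e - Poly_Mapping.single k 1) c \<in> carrier (poly_ring V)"
    using V keys_diff_subset by (intro poly_ring_single) blast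
  ultimately have "Poly_Mapping.single (e - Poly_Mapping.single k 1) c * Var k \<in> irrelevant_ideal V"
    using poly_ideal_mult[OF ideal_irrelevant_ideal] by blast
  moreover have "1 \<le> Poly_Mapping.lookup e k" using k by (auto simp: in_keys_iff)
  ultimately show ?case
    by (simp only: single_eq_Var_power_mult[of 1 e k c] mult.commute power_one_right)
qed (auto intro: poly_ideal_zero poly_ideal_add ideal_irrelevant_ideal)

text \<open>A form with a nonzero constant term is a nonzero constant, which cannot vanish at a
  vector of the nonempty \<open>P\<close>.\<close>

lemma point_ideal_constant_term:
  assumes "P \<noteq> {}" "f \<in> point_ideal V P"
  shows "weight_comp mono_degree 0 f = 0"
proof -
  let ?W = "{f \<in> carrier (poly_ring V). weight_comp mono_degree 0 f = 0}"
  have "ideal ?W (poly_ring V)"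
    by (rule ideal_poly_ringI)
      (auto simp: weight_comp_zero weight_comp_add weight_comp_mult[of mono_degree, OF mono_degree_add]
        intro: poly_ring_zero poly_ring_add poly_ring_mult)
  moreover have "f \<in> ?W"
    if f: "f \<in> carrier (poly_ring V)" "homogeneous f" "\<forall>v \<in> P. mpoly_eval v f = 0" for f
  proof -
    have "e \<notin> Poly_Mapping.keys f" if e: "mono_degree e = 0" for e
    proof
      assume "e \<in> Poly_Mapping.keys f"
      moreover obtain d where "\<forall>e\<in>Poly_Mapping.keys f. mono_degree e = d"
        using f(2) unfolding homogeneous_def by blast
      ultimately have "\<forall>e'\<in>Poly_Mapping.keys f. e' = 0"
        using e by (auto simp flip: mono_degree_eq_0_iff)
      with \<open>e \<in> _\<close> have keys: "Poly_Mapping.keys f = {0}"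
        by (simp add: set_eq_iff) (metis \<open>e \<in> _\<close>)
      then have "mpoly_eval v f = Poly_Mapping.lookup f 0" for v
        by (simp add: mpoly_eval_def)
      moreover have "Poly_Mapping.lookup f 0 \<noteq> 0" using keys by (simp add: lookup_not_eq_zero_eq_in_keys)
      ultimately show False using f(3) assms(1) by auto
    qed
    then have "weight_comp mono_degree 0 f = 0"
      by (intro poly_mapping_eqI) (auto simp: lookup_weight_comp when_def in_keys_iff)
    with f(1) show ?thesis by blast
  qed
  ultimately have "point_ideal V P \<subseteq> ?W"
    unfolding point_ideal_def by (intro genideal_poly_ring_minimal) auto
  with assms(2) show ?thesis by blast
qed

text \<open>A single point suffices: its ideal lies in the irrelevant ideal, and powers preserve the
  inclusion.\<close>

lemma symbolic_power_subset_irrelevant_pow: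
  assumes "Z \<noteq> {}" "{} \<notin> Z"
  shows "symbolic_power V Z m \<subseteq> ideal_pow (poly_ring V) (irrelevant_ideal V) m"
proof -
  obtain P where P: "P \<in> Z" "P \<noteq> {}" using assms by auto
  have "point_ideal V P \<subseteq> irrelevant_ideal V"
    using point_ideal_constant_term[OF P(2)] poly_ideal_subset[OF ideal_point_ideal]
    by (blast intro: in_irrelevant_idealI)
  then have "ideal_pow (poly_ring V) (point_ideal V P) m \<subseteq> ideal_pow (poly_ring V) (irrelevant_ideal V) m"
    by (rule ideal_pow_mono[OF order_refl])
  then show ?thesis using P(1) by (auto simp: symbolic_power_def)
qed

text \<open>By Euler's identity, d times the component of degree d is a sum of products of x_k with
  a derivative, and each derivative lies in the symbolic power of exponent \<open>s\<close>, hence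
  in \<open>J\<close>. Characteristic 0 makes every d > 0 invertible.\<close>

lemma symbolic_power_Suc_subset:
  fixes V :: "nat set" and Z :: "(nat \<Rightarrow> 'k::field) set set"
  assumes char: "CHAR('k) = 0" and "finite V" "Z \<noteq> {}" "{} \<notin> Z"
    and J: "ideal J (poly_ring V)" and s: "symbolic_power V Z s \<subseteq> J"
  shows "symbolic_power V Z (Suc s) \<subseteq> ideal_prod (poly_ring V) (irrelevant_ideal V) J"
proof
  let ?MJ = "ideal_prod (poly_ring V) (irrelevant_ideal V) J"
  note MJ = ideal_ideal_prod[OF ideal_irrelevant_ideal J]
  fix f assume f: "f \<in> symbolic_power V Z (Suc s)"
  have "weight_comp mono_degree d f \<in> ?MJ" for d
  proof (cases "d = 0")
    \<comment> \<open>In degree 0 one cannot divide by d, but the constant term vanishes since the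
      symbolic exponent is positive.\<close>
    case True
    obtain P where P: "P \<in> Z" "P \<noteq> {}" using assms by auto
    have "f \<in> point_ideal V P"
      using f P(1) symbolic_power_antimono[of "Suc 0" "Suc s" V Z] ideal_pow_1[OF ideal_point_ideal]
      unfolding symbolic_power_def by blast
    then show ?thesis using True point_ideal_constant_term[OF P(2)] poly_ideal_zero[OF MJ] by simp
  next
    case False
    let ?f = "weight_comp mono_degree d f"
    have "euler k ?f \<in> ?MJ" if "k \<in> V" for k
    proof -
      obtain g where "g \<in> symbolic_power V Z s" "euler k ?f = Var k * g"
        using euler_symbolic_power[OF assms(3) weight_comp_symbolic_power[OF f]] by blast
      moreover have "Var k \<in> irrelevant_ideal V"
        using that by (rule Var_in_irrelevant_ideal)
      ultimately show ?thesis using s by (auto intro: ideal_prodI)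
    qed
    then have "(\<Sum>k\<in>V. euler k ?f) \<in> ?MJ" by (rule poly_ideal_sum[OF MJ])
    moreover have "f \<in> carrier (poly_ring V)"
      using f poly_ideal_subset[OF ideal_symbolic_power[OF assms(3)]] by blast
    ultimately have "Poly_Mapping.single 0 (of_nat d) * ?f \<in> ?MJ"
      by (simp only: sum_euler_weight_comp assms(2))
    moreover have "Poly_Mapping.single 0 (inverse (of_nat d)) \<in> carrier (poly_ring V :: 'k mpoly ring)"
      by (rule poly_ring_single) simp
    ultimately have "Poly_Mapping.single 0 (inverse (of_nat d)) * (Poly_Mapping.single 0 (of_nat d) * ?f) \<in> ?MJ"
      by (metis poly_ideal_mult[OF MJ])
    moreover have "of_nat d \<noteq> (0::'k)" using False char by (simp add: of_nat_eq_0_iff_char_dvd)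
    then have "Poly_Mapping.single 0 (inverse (of_nat d)) * Poly_Mapping.single 0 (of_nat d) = (1 :: 'k mpoly)"
      by (simp del: single_of_nat add: mult_single)
    ultimately show ?thesis by (simp only: mult.assoc[symmetric] mult_1_left)
  qed
  then have "(\<Sum>d\<in>mono_degree ` Poly_Mapping.keys f. weight_comp mono_degree d f) \<in> ?MJ"
    by (rule poly_ideal_sum[OF MJ])
  then show "f \<in> ?MJ" by (simp add: sum_weight_comp)
qed

text \<open>Each step applies the previous lemma with \<open>J\<close> replaced by the product
  already reached, which gains one factor of the irrelevant ideal.\<close>

lemma symbolic_power_add_subset:
  fixes V :: "nat set" and Z :: "(nat \<Rightarrow> 'k::field) set set"
  assumes "CHAR('k) = 0" "finite V" "Z \<noteq> {}" "{} \<notin> Z" and J: "ideal J (poly_ring V)"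
    and s: "symbolic_power V Z s \<subseteq> ideal_prod (poly_ring V) (ideal_pow (poly_ring V) (irrelevant_ideal V) t) J"
  shows "symbolic_power V Z (s + k) \<subseteq>
    ideal_prod (poly_ring V) (ideal_pow (poly_ring V) (irrelevant_ideal V) (t + k)) J"
proof (induction k)
  case (Suc k)
  let ?S = "poly_ring V :: 'k mpoly ring" and ?M = "irrelevant_ideal V :: 'k mpoly set"
  note M = ideal_ideal_pow[OF ideal_irrelevant_ideal, of V]
  have "symbolic_power V Z (Suc (s + k)) \<subseteq> ideal_prod ?S ?M (ideal_prod ?S (ideal_pow ?S ?M (t + k)) J)"
    using assms Suc.IH by (intro symbolic_power_Suc_subset ideal_ideal_prod M)
  also have "\<dots> = ideal_prod ?S (ideal_prod ?S ?M (ideal_pow ?S ?M (t + k))) J"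
    by (rule ring.ideal_prod_assoc[OF cring.axioms(1)[OF cring_poly_ring] ideal_irrelevant_ideal M J, symmetric])
  also have "\<dots> = ideal_prod ?S (ideal_pow ?S ?M (Suc (t + k))) J"
    unfolding ideal_pow_Suc
    by (subst cring.ideal_prod_commute[OF cring_poly_ring ideal_irrelevant_ideal M]) (rule refl)
  finally show ?case by simp
qed (simp add: s)

section \<open>Passing from a hyperplane to the ambient space\<close>

abbreviation deg0 :: "(nat \<Rightarrow>\<^sub>0 nat) \<Rightarrow> nat"
  where "deg0 e \<equiv> Poly_Mapping.lookup e 0"

text \<open>This models the \<open>m\<close>-th power of the ideal generated by \<open>A\<close> and
  x_0. If 0 is not in \<open>V\<close>, then \<open>g\<close> is the coefficient of x_0^i; truncated
  subtraction lets it be any element of the smaller ring once \<open>i \<ge> m\<close>.\<close>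

definition x0_filtration :: "nat set \<Rightarrow> 'k::comm_ring_1 mpoly set \<Rightarrow> nat \<Rightarrow> 'k mpoly set"
  where "x0_filtration V A m = {f \<in> carrier (poly_ring (insert 0 V)).
    \<forall>i. \<exists>g\<in>ideal_pow (poly_ring V) A (m - i). weight_comp deg0 i f = Var 0 ^ i * g}"

lemma x0_filtration_0: "x0_filtration V A 0 = carrier (poly_ring (insert 0 V))"
proof -
  have "\<exists>g\<in>carrier (poly_ring V). weight_comp deg0 i f = Var 0 ^ i * g"
    if f: "f \<in> carrier (poly_ring (insert 0 V))" for f :: "'a mpoly" and i
  proof (induction f rule: poly_mapping_keys_induct)
    case zero
    show ?case using poly_ring_zero by (intro bexI[of _ 0]) (simp_all add: weight_comp_zero)
  next
    case (single e c)
    show ?case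
    proof (cases "deg0 e = i")
      case True
      \<comment> \<open>As \<open>i\<close> is the full exponent of x_0, the quotient no longer
        involves x_0.\<close>
      have "Poly_Mapping.keys (e - Poly_Mapping.single 0 i) \<subseteq> V"
      proof
        fix k assume k: "k \<in> Poly_Mapping.keys (e - Poly_Mapping.single 0 i)"
        have "k \<noteq> 0"
        proof
          assume "k = 0"
          with k True show False by (simp add: in_keys_iff lookup_minus)
        qed
        moreover have "k \<in> insert 0 V"
          using k keys_diff_subset single f by (fastforce simp: poly_ring_simps)
        ultimately show "k \<in> V" by simp
      qed
      moreover have "weight_comp deg0 i (Poly_Mapping.single e c) =
          Var 0 ^ i * Poly_Mapping.single (e - Poly_Mapping.single 0 i) c"
        unfolding weight_comp_single True when_simps simp_thms
        by (rule single_eq_Var_power_mult) (simp add: True)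
      ultimately show ?thesis using poly_ring_single by blast
    next
      case False
      then show ?thesis using poly_ring_zero by (intro bexI[of _ 0]) (simp_all add: weight_comp_single)
    qed
  next
    case (add p q)
    then obtain g h where "g \<in> carrier (poly_ring V)" "weight_comp deg0 i p = Var 0 ^ i * g"
        "h \<in> carrier (poly_ring V)" "weight_comp deg0 i q = Var 0 ^ i * h"
      by blast
    then show ?case by (intro bexI[of _ "g + h"]) (simp_all add: weight_comp_add distrib_left poly_ring_add)
  qed
  then show ?thesis
    unfolding x0_filtration_def diff_0_eq_0 ideal_pow_0 by blast
qed

text \<open>The coefficient of x_0^d in a product is the convolution of the coefficients of the
  factors.\<close>

lemma x0_filtration_mult:
  assumes A: "ideal A (poly_ring V)"
    and p: "p \<in> x0_filtration V A m" and q: "q \<in> x0_filtration V A n"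
  shows "p * q \<in> x0_filtration V A (m + n)"
proof -
  obtain g where g: "\<And>i. g i \<in> ideal_pow (poly_ring V) A (m - i)"
      "\<And>i. weight_comp deg0 i p = Var 0 ^ i * g i"
    using p unfolding x0_filtration_def by (auto simp: Bex_def dest!: choice)
  obtain h where h: "\<And>i. h i \<in> ideal_pow (poly_ring V) A (n - i)"
      "\<And>i. weight_comp deg0 i q = Var 0 ^ i * h i"
    using q unfolding x0_filtration_def by (auto simp: Bex_def dest!: choice)
  have "\<exists>f\<in>ideal_pow (poly_ring V) A (m + n - d). weight_comp deg0 d (p * q) = Var 0 ^ d * f" for d
  proof (intro bexI)
    have "weight_comp deg0 d (p * q) = (\<Sum>i\<le>d. Var 0 ^ i * g i * (Var 0 ^ (d - i) * h (d - i)))"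
      by (simp add: weight_comp_mult lookup_add g h)
    also have "\<dots> = (\<Sum>i\<le>d. Var 0 ^ d * (g i * h (d - i)))"
    proof (rule sum.cong)
      fix i assume "i \<in> {..d}"
      then have "Var 0 ^ d = Var 0 ^ i * (Var 0 ^ (d - i) :: 'a mpoly)"
        by (simp flip: power_add)
      then show "Var 0 ^ i * g i * (Var 0 ^ (d - i) * h (d - i)) = Var 0 ^ d * (g i * h (d - i))"
        by (simp add: algebra_simps)
    qed simp
    finally show "weight_comp deg0 d (p * q) = Var 0 ^ d * (\<Sum>i\<le>d. g i * h (d - i))"
      by (simp add: sum_distrib_left)
    have "g i * h (d - i) \<in> ideal_pow (poly_ring V) A (m + n - d)" if "i \<le> d" for i
    proof -
      have "g i * h (d - i) \<in> ideal_pow (poly_ring V) A ((m - i) + (n - (d - i)))"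
        by (rule ideal_pow_mult[OF A g(1) h(1)])
      \<comment> \<open>Only an inequality, since either difference on the right may be truncated at
        0.\<close>
      moreover have "m + n - d \<le> (m - i) + (n - (d - i))" using that by linarith
      ultimately show ?thesis using ideal_pow_antimono[OF A] by blast
    qed
    then show "(\<Sum>i\<le>d. g i * h (d - i)) \<in> ideal_pow (poly_ring V) A (m + n - d)"
      by (intro poly_ideal_sum[OF ideal_ideal_pow[OF A]]) auto
  qed
  moreover have "p * q \<in> carrier (poly_ring (insert 0 V))"
    using p q by (auto simp: x0_filtration_def intro: poly_ring_mult)
  ultimately show ?thesis by (simp add: x0_filtration_def)
qed

lemma x0_filtration_add:
  assumes A: "ideal A (poly_ring V)"
    and p: "p \<in> x0_filtration V A m" and q: "q \<in> x0_filtration V A m"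
  shows "p + q \<in> x0_filtration V A m"
proof -
  have "\<exists>f\<in>ideal_pow (poly_ring V) A (m - i). weight_comp deg0 i (p + q) = Var 0 ^ i * f" for i
  proof -
    obtain g h where "g \<in> ideal_pow (poly_ring V) A (m - i)" "weight_comp deg0 i p = Var 0 ^ i * g"
        "h \<in> ideal_pow (poly_ring V) A (m - i)" "weight_comp deg0 i q = Var 0 ^ i * h"
      using p q unfolding x0_filtration_def by blast
    then show ?thesis
      by (intro bexI[of _ "g + h"]) (simp_all add: weight_comp_add distrib_left poly_ideal_add[OF ideal_ideal_pow[OF A]])
  qed
  then show ?thesis using p q by (simp add: x0_filtration_def poly_ring_add)
qed

lemma ideal_x0_filtration:
  assumes A: "ideal A (poly_ring V)"
  shows "ideal (x0_filtration V A m) (poly_ring (insert 0 V))"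
proof (rule ideal_poly_ringI)
  show "x0_filtration V A m \<subseteq> carrier (poly_ring (insert 0 V))" by (auto simp: x0_filtration_def)
  show "0 \<in> x0_filtration V A m"
    unfolding x0_filtration_def
    by (auto simp: weight_comp_zero poly_ring_zero intro!: bexI[of _ 0] poly_ideal_zero ideal_ideal_pow A)
  show "a + b \<in> x0_filtration V A m" if "a \<in> x0_filtration V A m" "b \<in> x0_filtration V A m" for a b
    using A that by (rule x0_filtration_add)
  \<comment> \<open>The whole ring is the filtration at exponent 0, so absorption is a case of
    multiplicativity.\<close>
  show "x * a \<in> x0_filtration V A m"
    if "a \<in> x0_filtration V A m" "x \<in> carrier (poly_ring (insert 0 V))" for a x
    using x0_filtration_mult[OF A, of x 0 a m] that by (simp add: x0_filtration_0)
qed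

text \<open>At exponent 1 only the layer free of x_0 is constrained. Setting x_0 = 0 in a form
  vanishing on \<open>P\<close> yields a form in the smaller ring with the same values on
  \<open>P\<close>.\<close>

lemma point_ideal_subset_x0_filtration:
  assumes P: "\<And>v. v \<in> P \<Longrightarrow> v 0 = 0"
  shows "point_ideal (insert 0 V) P \<subseteq> x0_filtration V (point_ideal V P) 1"
  unfolding point_ideal_def[of "insert 0 V"]
proof (rule genideal_poly_ring_minimal[OF ideal_x0_filtration[OF ideal_point_ideal]], safe)
  fix f assume f: "f \<in> carrier (poly_ring (insert 0 V))" "homogeneous f" "\<forall>v\<in>P. mpoly_eval v f = 0"
  \<comment> \<open>At exponent 0 the filtration merely records divisibility by x_0^i, so any set,
    here \<open>{}\<close>, can stand for the ideal.\<close>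
  have f0: "\<exists>g\<in>carrier (poly_ring V). weight_comp deg0 i f = Var 0 ^ i * g" for i
    using x0_filtration_0[of V "{}"] f(1)
    by (auto simp: x0_filtration_def ideal_pow_0 set_eq_iff simp del: Group.nat_pow_0)
  have "weight_comp deg0 0 f \<in> point_ideal V P"
    unfolding point_ideal_def
  proof (rule genideal_poly_ring_self, safe)
    show "weight_comp deg0 0 f \<in> carrier (poly_ring V)" using f0[of 0] by auto
    show "homogeneous (weight_comp deg0 0 f)" using f(2) by (auto simp: homogeneous_def keys_weight_comp)
    fix v assume v: "v \<in> P"
    have "mpoly_eval v f = mpoly_eval v (weight_comp deg0 0 f)"
      unfolding mpoly_eval_def keys_weight_comp
    proof (rule sum.mono_neutral_cong_right)
      show "\<forall>e\<in>Poly_Mapping.keys f - {e \<in> Poly_Mapping.keys f. deg0 e = 0}.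
          Poly_Mapping.lookup f e * (\<Prod>i\<in>Poly_Mapping.keys e. v i ^ Poly_Mapping.lookup e i) = 0"
        using P[OF v] by (auto simp: prod_zero_iff in_keys_iff intro!: bexI[of _ 0])
    qed (auto simp: lookup_weight_comp)
    with f(3) v show "mpoly_eval v (weight_comp deg0 0 f) = 0" by simp
  qed
  then have "\<exists>g\<in>ideal_pow (poly_ring V) (point_ideal V P) (1 - i). weight_comp deg0 i f = Var 0 ^ i * g" for i
    using f0[of i]
    by (cases i) (auto simp: ideal_pow_0 ideal_pow_1[OF ideal_point_ideal] simp del: Group.nat_pow_0 Group.nat_pow_Suc)
  with f(1) show "f \<in> x0_filtration V (point_ideal V P) 1" by (simp add: x0_filtration_def)
qed

lemma ideal_pow_subset_x0_filtration:
  assumes A: "ideal A (poly_ring V)" and B: "B \<subseteq> x0_filtration V A 1"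
  shows "ideal_pow (poly_ring (insert 0 V)) B m \<subseteq> x0_filtration V A m"
proof (induction m)
  case 0 then show ?case by (simp only: ideal_pow_0 x0_filtration_0)
next
  case (Suc m)
  show ?case
  proof
    fix f assume "f \<in> ideal_pow (poly_ring (insert 0 V)) B (Suc m)"
    then show "f \<in> x0_filtration V A (Suc m)" unfolding ideal_pow_Suc
    proof (induction rule: ideal_prod_poly_induct)
      case (prod a b)
      then show ?case using x0_filtration_mult[OF A, of a m b 1] Suc.IH B by auto
    qed (rule x0_filtration_add[OF A])
  qed
qed

text \<open>Reduces a containment of ambient symbolic powers to single layers x_0^i * g, where g
  lies in a symbolic power of the smaller ring.\<close>

lemma symbolic_power_insert_subset:
  assumes "Z \<noteq> {}" and Z: "\<forall>P\<in>Z. \<forall>v\<in>P. v 0 = 0"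
    and B: "ideal B (poly_ring (insert 0 V))"
    and step: "\<And>i g. g \<in> symbolic_power V Z (m - i) \<Longrightarrow> Var 0 ^ i * g \<in> B"
  shows "symbolic_power (insert 0 V) Z m \<subseteq> B"
proof
  fix f assume f: "f \<in> symbolic_power (insert 0 V) Z m"
  have "weight_comp deg0 i f \<in> B" for i
  proof -
    have *: "\<exists>g\<in>ideal_pow (poly_ring V) (point_ideal V P) (m - i). weight_comp deg0 i f = Var 0 ^ i * g"
      if P: "P \<in> Z" for P
    proof -
      have "point_ideal (insert 0 V) P \<subseteq> x0_filtration V (point_ideal V P) 1"
        by (rule point_ideal_subset_x0_filtration) (use Z P in blast)
      then have "ideal_pow (poly_ring (insert 0 V)) (point_ideal (insert 0 V) P) m
          \<subseteq> x0_filtration V (point_ideal V P) m"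
        by (rule ideal_pow_subset_x0_filtration[OF ideal_point_ideal])
      with f P have "f \<in> x0_filtration V (point_ideal V P) m" by (auto simp: symbolic_power_def)
      then show ?thesis by (simp add: x0_filtration_def)
    qed
    \<comment> \<open>Cancelling the power of x_0 shows that this cofactor is the one for every
      point, so it lies in the intersection.\<close>
    obtain g where g: "weight_comp deg0 i f = Var 0 ^ i * g" using assms(1) * by blast
    have "g \<in> ideal_pow (poly_ring V) (point_ideal V P) (m - i)" if "P \<in> Z" for P
      using *[OF that] unfolding g mult_left_cancel[OF Var_power_nonzero] by auto
    then have "g \<in> symbolic_power V Z (m - i)" by (simp add: symbolic_power_def)
    then show ?thesis unfolding g by (rule step)
  qed
  then have "(\<Sum>i\<in>deg0 ` Poly_Mapping.keys f. weight_comp deg0 i f) \<in> B"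
    by (rule poly_ideal_sum[OF B])
  then show "f \<in> B" by (simp add: sum_weight_comp)
qed

section \<open>Enlarging the set of variables\<close>

lemma point_ideal_mono:
  assumes "V \<subseteq> W"
  shows "point_ideal V P \<subseteq> point_ideal W P"
  unfolding point_ideal_def
  by (rule genideal_poly_ring_mono[OF assms]) (use poly_ring_mono[OF assms] in auto)

lemma points_ideal_mono: "V \<subseteq> W \<Longrightarrow> points_ideal V Z \<subseteq> points_ideal W Z"
  unfolding points_ideal_def by (intro INF_mono) (auto dest: point_ideal_mono)

lemma irrelevant_ideal_mono: "V \<subseteq> W \<Longrightarrow> irrelevant_ideal V \<subseteq> irrelevant_ideal W"
  unfolding irrelevant_ideal_def by (rule genideal_poly_ring_mono) (auto intro: poly_ring_Var)

text \<open>Applied with \<open>k = 0\<close>: x_0 is a form vanishing on the hyperplane.\<close>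

lemma Var_in_points_ideal:
  assumes "k \<in> V" and Z: "\<forall>P\<in>Z. \<forall>v\<in>P. v k = 0"
  shows "Var k \<in> points_ideal V Z"
proof -
  have "Var k \<in> point_ideal V P" if "P \<in> Z" for P
    unfolding point_ideal_def
  proof (rule genideal_poly_ring_self, safe)
    show "homogeneous (Var k)" by (auto simp: homogeneous_def Var_def)
    show "mpoly_eval v (Var k) = 0" if "v \<in> P" for v
      using Z \<open>P \<in> Z\<close> that by (simp add: mpoly_eval_def Var_def)
  qed (use assms(1) in \<open>rule poly_ring_Var\<close>)
  then show ?thesis by (simp add: points_ideal_def)
qed

section \<open>Containments in the ambient ring, layer by layer\<close>

context
  fixes V :: "nat set" and Z :: "(nat \<Rightarrow> 'k::field) set set"
  assumes Z: "Z \<noteq> {}" "\<forall>P\<in>Z. \<forall>v\<in>P. v 0 = 0"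
begin

text \<open>In layer \<open>i\<close>, the factor x_0^i supplies \<open>i\<close> factors from the
  ideal of the points, and the hypothesis supplies the remaining \<open>r - i\<close>. For
  \<open>i \<ge> r\<close> the power of x_0 is enough.\<close>

lemma symbolic_power_insert_subset_pow:
  assumes s: "\<And>i. i < r \<Longrightarrow> symbolic_power V Z (s - i) \<subseteq> ideal_pow (poly_ring V) (points_ideal V Z) (r - i)"
  shows "symbolic_power (insert 0 V) Z s \<subseteq> ideal_pow (poly_ring (insert 0 V)) (points_ideal (insert 0 V) Z) r"
proof -
  let ?W = "insert 0 V"
  let ?I = "points_ideal ?W Z"
  note I = ideal_points_ideal[OF Z(1), of ?W]
  have x0: "Var 0 ^ i \<in> ideal_pow (poly_ring ?W) ?I i" for i
    by (intro power_in_ideal_pow[OF I] Var_in_points_ideal Z(2)) simp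
  show ?thesis
  proof (rule symbolic_power_insert_subset[OF Z ideal_ideal_pow[OF I]])
    fix i g assume g: "g \<in> symbolic_power V Z (s - i)"
    have "g \<in> ideal_pow (poly_ring ?W) ?I (r - i)"
    proof (cases "i < r")
      case True
      have "ideal_pow (poly_ring V) (points_ideal V Z) (r - i) \<subseteq> ideal_pow (poly_ring ?W) ?I (r - i)"
        by (intro ideal_pow_mono points_ideal_mono) auto
      with s[OF True] g show ?thesis by blast
    next
      case False
      have "g \<in> carrier (poly_ring V)" using g poly_ideal_subset[OF ideal_symbolic_power[OF Z(1)]] by blast
      with False show ?thesis
        using poly_ring_mono[of V ?W] by (auto simp: ideal_pow_0 simp del: Group.nat_pow_0)
    qed
    from ideal_pow_mult[OF I x0 this] have "Var 0 ^ i * g \<in> ideal_pow (poly_ring ?W) ?I (i + (r - i))" .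
    then show "Var 0 ^ i * g \<in> ideal_pow (poly_ring ?W) ?I r"
      by (rule subsetD[OF ideal_pow_antimono[OF I], rotated]) simp
  qed
qed

text \<open>The bound on \<open>r\<close> ensures that every layer with \<open>i > u\<close>
  contains the full factor x_0^r.\<close>

lemma symbolic_power_insert_subset_prod:
  assumes char: "CHAR('k) = 0" and V: "finite V" "{} \<notin> Z"
    and s: "symbolic_power V Z (t + r) \<subseteq>
      ideal_prod (poly_ring V) (ideal_pow (poly_ring V) (irrelevant_ideal V) t)
        (ideal_pow (poly_ring V) (points_ideal V Z) r)"
    and u: "r \<le> Suc u"
  shows "symbolic_power (insert 0 V) Z (t + r + u) \<subseteq>
      ideal_prod (poly_ring (insert 0 V)) (ideal_pow (poly_ring (insert 0 V)) (irrelevant_ideal (insert 0 V)) (t + u))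
        (ideal_pow (poly_ring (insert 0 V)) (points_ideal (insert 0 V) Z) r)"
proof -
  let ?W = "insert 0 V"
  let ?I = "points_ideal ?W Z" and ?M = "irrelevant_ideal ?W :: 'k mpoly set"
  let ?B = "ideal_prod (poly_ring ?W) (ideal_pow (poly_ring ?W) ?M (t + u)) (ideal_pow (poly_ring ?W) ?I r)"
  note I = ideal_points_ideal[OF Z(1), of ?W] and M = ideal_irrelevant_ideal[of ?W]
  have B: "ideal ?B (poly_ring ?W)" by (intro ideal_ideal_prod ideal_ideal_pow I M)
  have x0_I: "Var 0 ^ i \<in> ideal_pow (poly_ring ?W) ?I i" for i
    by (intro power_in_ideal_pow[OF I] Var_in_points_ideal Z(2)) simp
  have x0_M: "Var 0 ^ i \<in> ideal_pow (poly_ring ?W) ?M i" for i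
    by (intro power_in_ideal_pow[OF M] Var_in_irrelevant_ideal) simp
  have M_mono: "ideal_pow (poly_ring V) (irrelevant_ideal V) m \<subseteq> ideal_pow (poly_ring ?W) ?M m" for m
    by (intro ideal_pow_mono irrelevant_ideal_mono) auto
  have I_mono: "ideal_pow (poly_ring V) (points_ideal V Z) m \<subseteq> ideal_pow (poly_ring ?W) ?I m" for m
    by (intro ideal_pow_mono points_ideal_mono) auto
  show ?thesis
  proof (rule symbolic_power_insert_subset[OF Z B])
    fix i g assume g: "g \<in> symbolic_power V Z (t + r + u - i)"
    show "Var 0 ^ i * g \<in> ?B"
    proof (cases "i \<le> u")
      case True
      \<comment> \<open>The symbolic exponent exceeds \<open>t + r\<close> by \<open>u - i\<close>,
        which yields that many extra factors of the irrelevant ideal; x_0^i then supplies the other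
        \<open>i\<close>.\<close>
      have "symbolic_power V Z (t + r + (u - i)) \<subseteq>
          ideal_prod (poly_ring V) (ideal_pow (poly_ring V) (irrelevant_ideal V) (t + (u - i)))
            (ideal_pow (poly_ring V) (points_ideal V Z) r)"
        by (intro symbolic_power_add_subset[OF char V(1) Z(1) V(2) _ s] ideal_ideal_pow ideal_points_ideal Z(1))
      also have "\<dots> \<subseteq> ideal_prod (poly_ring ?W) (ideal_pow (poly_ring ?W) ?M (t + (u - i)))
          (ideal_pow (poly_ring ?W) ?I r)"
        using M_mono I_mono by (rule ideal_prod_poly_mono)
      finally have "g \<in> ideal_prod (poly_ring ?W) (ideal_pow (poly_ring ?W) ?M (t + (u - i)))
          (ideal_pow (poly_ring ?W) ?I r)"
        using g True by auto
      then show ?thesis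
      proof (induction rule: ideal_prod_poly_induct)
        case (prod a b)
        have "Var 0 ^ i * a \<in> ideal_pow (poly_ring ?W) ?M (i + (t + (u - i)))"
          by (rule ideal_pow_mult[OF M x0_M prod(1)])
        then have "Var 0 ^ i * a \<in> ideal_pow (poly_ring ?W) ?M (t + u)" using True by simp
        from ideal_prodI[OF this prod(2)] show ?case by (simp only: mult.assoc)
      qed (simp add: distrib_left poly_ideal_add[OF B])
    next
      case False
      have "g \<in> ideal_pow (poly_ring ?W) ?M (t + r + u - i)"
        using g symbolic_power_subset_irrelevant_pow[OF Z(1) V(2)] M_mono by blast
      with x0_M have "Var 0 ^ (i - r) * g \<in> ideal_pow (poly_ring ?W) ?M ((i - r) + (t + r + u - i))"
        by (rule ideal_pow_mult[OF M])
      \<comment> \<open>Equality for \<open>i \<le> t + r + u\<close>; beyond that the difference is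
        truncated and \<open>i - r\<close> alone exceeds \<open>t + u\<close>.\<close>
      moreover have "t + u \<le> (i - r) + (t + r + u - i)" using False u by linarith
      ultimately have "Var 0 ^ (i - r) * g \<in> ideal_pow (poly_ring ?W) ?M (t + u)"
        using ideal_pow_antimono[OF M] by blast
      from ideal_prodI[OF this x0_I[of r]]
      have "Var 0 ^ (i - r) * g * Var 0 ^ r \<in> ?B" .
      moreover have "Var 0 ^ i = Var 0 ^ (i - r) * (Var 0 ^ r :: 'k mpoly)"
        using False u by (simp flip: power_add)
      ultimately show ?thesis by (simp add: mult_ac)
    qed
  qed
qed

end

section \<open>Choice of exponents for (a), (b) and (c)\<close>

theorem proposition7p1:
  fixes N n :: nat
    and P :: "nat \<Rightarrow> (nat \<Rightarrow> 'k::alg_closed_field) set"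
    and V V' :: "nat set"
    and S S' :: "'k mpoly ring"
    and I I' M M' :: "'k mpoly set"
    and Isym Isym' :: "nat \<Rightarrow> 'k mpoly set"
  assumes "N \<ge> 1"
    and "n \<ge> 1"
    and "P ` {1..n} \<subseteq> hyperplane0 N"
    and "inj_on P {1..n}"
  defines "V \<equiv> {1..N+1}"
    and "V' \<equiv> {0..N+1}"
  defines "S \<equiv> poly_ring V"
    and "S' \<equiv> poly_ring V'"
    and "I \<equiv> points_ideal V (P ` {1..n})"
    and "I' \<equiv> points_ideal V' (P ` {1..n})"
    and "Isym \<equiv> symbolic_power V (P ` {1..n})"
    and "Isym' \<equiv> symbolic_power V' (P ` {1..n})"
    and "M \<equiv> irrelevant_ideal V"
    and "M' \<equiv> irrelevant_ideal V'"
  shows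
    "(CHAR('k) = 0 \<longrightarrow>
        (\<forall>r\<ge>1. Isym (r * N) \<subseteq> ideal_prod S (ideal_pow S M (r * (N - 1))) (ideal_pow S I r) \<longrightarrow>
               Isym' (r * (N + 1)) \<subseteq> ideal_prod S' (ideal_pow S' M' (r * N)) (ideal_pow S' I' r)) \<and>
        ((\<forall>r\<ge>1. Isym (r * N) \<subseteq> ideal_prod S (ideal_pow S M (r * (N - 1))) (ideal_pow S I r)) \<longrightarrow>
         (\<forall>r\<ge>1. Isym' (r * (N + 1)) \<subseteq> ideal_prod S' (ideal_pow S' M' (r * N)) (ideal_pow S' I' r)))) \<and>
     ((\<forall>r\<ge>1. Isym (r * N - (N - 1)) \<subseteq> ideal_pow S I r) \<longrightarrow>
        (\<forall>r\<ge>1. Isym' (r * (N + 1) - N) \<subseteq> Isym' (r * N - (N - 1)) \<and>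
               Isym' (r * N - (N - 1)) \<subseteq> ideal_pow S' I' r)) \<and>
     (CHAR('k) = 0 \<longrightarrow>
        (\<forall>r\<ge>1. Isym (r * N - (N - 1)) \<subseteq>
                 ideal_prod S (ideal_pow S M ((r - 1) * (N - 1))) (ideal_pow S I r) \<longrightarrow>
               Isym' (r * (N + 1) - N) \<subseteq>
                 ideal_prod S' (ideal_pow S' M' ((r - 1) * N)) (ideal_pow S' I' r)) \<and>
        ((\<forall>r\<ge>1. Isym (r * N - (N - 1)) \<subseteq>
                 ideal_prod S (ideal_pow S M ((r - 1) * (N - 1))) (ideal_pow S I r)) \<longrightarrow>
         (\<forall>r\<ge>1. Isym' (r * (N + 1) - N) \<subseteq>
                 ideal_prod S' (ideal_pow S' M' ((r - 1) * N)) (ideal_pow S' I' r))))"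
proof -
  let ?Z = "P ` {1..n}"
  have V': "V' = insert 0 V" unfolding V_def V'_def by auto
  have Z: "?Z \<noteq> {}" "\<forall>p\<in>?Z. \<forall>v\<in>p. v 0 = 0"
    using assms(2,3) by (auto simp: hyperplane0_def)
  have V: "finite V" "{} \<notin> ?Z"
  proof -
    \<comment> \<open>Points are equivalence classes, hence nonempty sets of coordinate
      vectors.\<close>
    have "p \<noteq> {}" if "p \<in> proj_space {0..N+1}" for p :: "(nat \<Rightarrow> 'k) set"
      using that in_quotient_imp_non_empty[OF equiv_proportional] unfolding proj_space_def by blast
    with assms(3) show "{} \<notin> ?Z" by (fastforce simp: hyperplane0_def)
  qed (simp add: V_def)
  have key: "Isym' (t + r + u) \<subseteq> ideal_prod S' (ideal_pow S' M' (t + u)) (ideal_pow S' I' r)"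
    if "CHAR('k) = 0" "r \<le> Suc u"
      "Isym (t + r) \<subseteq> ideal_prod S (ideal_pow S M t) (ideal_pow S I r)" for t r u
    using symbolic_power_insert_subset_prod[OF Z that(1) V _ that(2)] that(3)
    unfolding S_def S'_def I_def I'_def Isym_def Isym'_def M_def M'_def V' by blast
  obtain N' where N: "N = Suc N'" using assms(1) by (cases N) auto
  \<comment> \<open>Here \<open>t = r * (N - 1)\<close> and \<open>u = r\<close>, so
    \<open>t + r\<close> and \<open>t + u\<close> are both \<open>r * N\<close>, and
    \<open>t + r + u\<close> is \<open>r * (N + 1)\<close>.\<close>
  have a: "Isym' (r * (N + 1)) \<subseteq> ideal_prod S' (ideal_pow S' M' (r * N)) (ideal_pow S' I' r)"
    if "CHAR('k) = 0" "Isym (r * N) \<subseteq> ideal_prod S (ideal_pow S M (r * (N - 1))) (ideal_pow S I r)" for r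
    using key[of r r "r * (N - 1)"] that by (simp add: N algebra_simps)
  \<comment> \<open>The two exponents differ by \<open>r - 1\<close>.\<close>
  have b1: "Isym' (r * (N + 1) - N) \<subseteq> Isym' (r * N - (N - 1))" if "r \<ge> 1" for r
    unfolding Isym'_def using that by (intro symbolic_power_antimono) (simp add: N)
  have b2: "Isym' (r * N - (N - 1)) \<subseteq> ideal_pow S' I' r"
    if b: "\<forall>r\<ge>1. Isym (r * N - (N - 1)) \<subseteq> ideal_pow S I r" for r
    unfolding Isym'_def S'_def I'_def V'
  proof (rule symbolic_power_insert_subset_pow[OF Z])
    fix i assume i: "i < r"
    then obtain k where k: "r = i + Suc k" by (metis less_iff_Suc_add add_Suc_right)
    \<comment> \<open>Replacing \<open>r\<close> by \<open>r - i\<close> lowers the exponent by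
      \<open>i * N\<close>, which is at least \<open>i\<close>. The hypothesis is thus used at all
      exponents \<open>r - i\<close> with \<open>i < r\<close>.\<close>
    have "Isym (r * N - (N - 1) - i) \<subseteq> Isym ((r - i) * N - (N - 1))"
      unfolding Isym_def by (intro symbolic_power_antimono) (simp add: N k algebra_simps)
    also have "\<dots> \<subseteq> ideal_pow S I (r - i)" using b i by simp
    finally show "symbolic_power V ?Z (r * N - (N - 1) - i) \<subseteq>
        ideal_pow (poly_ring V) (points_ideal V ?Z) (r - i)"
      unfolding Isym_def S_def I_def .
  qed
  have c: "Isym' (r * (N + 1) - N) \<subseteq> ideal_prod S' (ideal_pow S' M' ((r - 1) * N)) (ideal_pow S' I' r)"
    if char: "CHAR('k) = 0" and r: "r \<ge> 1" and hyp: "Isym (r * N - (N - 1)) \<subseteq>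
      ideal_prod S (ideal_pow S M ((r - 1) * (N - 1))) (ideal_pow S I r)" for r
  proof -
    obtain q where q: "r = Suc q" using r by (cases r) auto
    \<comment> \<open>Here \<open>t = (r - 1) * (N - 1)\<close> and \<open>u = r - 1\<close>, the
      boundary case \<open>r = Suc u\<close>. Then \<open>t + r\<close> is
      \<open>r * N - (N - 1)\<close>, \<open>t + r + u\<close> is \<open>r * (N + 1) - N\<close>,
      and \<open>t + u\<close> is \<open>(r - 1) * N\<close>.\<close>
    show ?thesis
      using key[of r q "q * N'"] char hyp by (simp add: N q algebra_simps del: Group.nat_pow_Suc)
  qed
  show ?thesis using a b1 b2 c by blast
qed

end
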